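(* Let $\alpha$ be a primitive substitution of constant length $L>1$ whose associated symbolic system $(X_\alpha,\sigma)$ is infinite. Then there exist infinitely many primitive substitutions $\beta$ of constant length $L$ (pairwise not obtainable from each other by renaming symbols) such that the symbolic system $(X_\beta,\sigma)$ is topologically conjugate to $(X_\alpha,\sigma)$.
   Context: An alphabet is a finite set $A$ with at least two elements. A substitution on $A$ is a map $\alpha:A\to A^*$, extended to finite and infinite words by juxtaposition; it has constant length $L$ if $\alpha(a)\in A^L$ for every $a\in A$. It is primitive if for some $n>0$ and every $a\in A$ the word $\alpha^n(a)$ contains every letter of $A$. The language $\mathcal{L}_\alpha\subseteq A^*$ is the set of all factors (words of consecutive letters) of words $\alpha^n(a)$, $a\in A$, $n\ge 1$. $X_\alpha\subseteq A^{\mathbb{Z}}$ is the set of bi-infinite sequences all of whose finite factors lie in $\mathcal{L}_\alpha$, and $\sigma$ is the left shift. Two systems $(X,\sigma)$, $(Y,\sigma)$ are topologically conjugate if there is a homeomorphism $X\to Y$ commuting with $\sigma$. Substitutions differing only by a bijective renaming of the symbols of the alphabet are regarded as the same. *)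

theory Defs
  imports "HOL-Analysis.Analysis" "HOL-Library.Sublist"
begin

(* A substitution is a function on a whole type together with an explicit alphabet A;
   its values outside A carry no meaning. *)

definition alphabet :: "'a set \<Rightarrow> bool" where
  "alphabet A \<longleftrightarrow> finite A \<and> card A \<ge> 2"

definition substitution_on :: "'a set \<Rightarrow> ('a \<Rightarrow> 'a list) \<Rightarrow> bool" where
  "substitution_on A \<alpha> \<longleftrightarrow> alphabet A \<and> \<alpha> \<in> A \<rightarrow> lists A"

definition subst_word :: "('a \<Rightarrow> 'a list) \<Rightarrow> 'a list \<Rightarrow> 'a list" where
  "subst_word \<alpha> w = concat (map \<alpha> w)"

definition constant_length :: "'a set \<Rightarrow> ('a \<Rightarrow> 'a list) \<Rightarrow> nat \<Rightarrow> bool" where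
  "constant_length A \<alpha> L \<longleftrightarrow> (\<forall>a\<in>A. length (\<alpha> a) = L)"

definition primitive_subst :: "'a set \<Rightarrow> ('a \<Rightarrow> 'a list) \<Rightarrow> bool" where
  "primitive_subst A \<alpha> \<longleftrightarrow> (\<exists>n>0. \<forall>a\<in>A. A \<subseteq> set ((subst_word \<alpha> ^^ n) [a]))"

definition subst_language :: "'a set \<Rightarrow> ('a \<Rightarrow> 'a list) \<Rightarrow> 'a list set" where
  "subst_language A \<alpha> = {w. \<exists>a\<in>A. \<exists>n\<ge>1. sublist w ((subst_word \<alpha> ^^ n) [a])}"

definition factor_at :: "(int \<Rightarrow> 'a) \<Rightarrow> int \<Rightarrow> nat \<Rightarrow> 'a list" where
  "factor_at x i n = map (\<lambda>k. x (i + int k)) [0..<n]"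

definition subst_shift :: "'a set \<Rightarrow> ('a \<Rightarrow> 'a list) \<Rightarrow> (int \<Rightarrow> 'a) set" where
  "subst_shift A \<alpha> = {x \<in> UNIV \<rightarrow> A. \<forall>i n. factor_at x i n \<in> subst_language A \<alpha>}"

definition left_shift :: "(int \<Rightarrow> 'a) \<Rightarrow> (int \<Rightarrow> 'a)" where
  "left_shift x = (\<lambda>i. x (i + 1))"

definition subst_topology :: "'a set \<Rightarrow> ('a \<Rightarrow> 'a list) \<Rightarrow> (int \<Rightarrow> 'a) topology" where
  "subst_topology A \<alpha> =
     subtopology (product_topology (\<lambda>_. discrete_topology A) UNIV) (subst_shift A \<alpha>)"

definition topologically_conjugate ::
  "'a set \<Rightarrow> ('a \<Rightarrow> 'a list) \<Rightarrow> 'b set \<Rightarrow> ('b \<Rightarrow> 'b list) \<Rightarrow> bool" where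
  "topologically_conjugate A \<alpha> B \<beta> \<longleftrightarrow>
     (\<exists>h. homeomorphic_map (subst_topology A \<alpha>) (subst_topology B \<beta>) h \<and>
          (\<forall>x\<in>subst_shift A \<alpha>. h (left_shift x) = left_shift (h x)))"

definition renaming_equivalent ::
  "'a set \<Rightarrow> ('a \<Rightarrow> 'a list) \<Rightarrow> 'b set \<Rightarrow> ('b \<Rightarrow> 'b list) \<Rightarrow> bool" where
  "renaming_equivalent A \<alpha> B \<beta> \<longleftrightarrow>
     (\<exists>f. bij_betw f A B \<and> (\<forall>a\<in>A. \<beta> (f a) = map f (\<alpha> a)))"

lemma topspace_subst_topology: "topspace (subst_topology A \<alpha>) = subst_shift A \<alpha>"
  by (auto simp: subst_topology_def subst_shift_def)

end

theory Submission
  imports Defs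
begin

text \<open>
  The substitutions are the \<open>N\<close>-block presentations of \<open>\<alpha>\<close>: the letters are the words \<open>w\<close> of
  length \<open>N\<close> in the language, and \<open>w\<close> is sent to the first \<open>L\<close> windows of length \<open>N\<close> of \<open>\<alpha>(w)\<close>.
  The sliding block code reading off all windows of length \<open>N\<close> conjugates the two systems.
  Since the system is infinite, the number of words of length \<open>N\<close> is unbounded in \<open>N\<close>, so
  infinitely many alphabet sizes occur.
\<close>

section \<open>Iterates and languages of substitutions\<close>

lemma subst_word_append: "subst_word \<alpha> (u @ v) = subst_word \<alpha> u @ subst_word \<alpha> v"
  by (simp add: subst_word_def)

lemma subst_word_pow_append:
  "(subst_word \<alpha> ^^ n) (u @ v) = (subst_word \<alpha> ^^ n) u @ (subst_word \<alpha> ^^ n) v"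
  by (induction n) (simp_all add: subst_word_append)

lemma sublist_subst_word_pow:
  "sublist u v \<Longrightarrow> sublist ((subst_word \<alpha> ^^ n) u) ((subst_word \<alpha> ^^ n) v)"
  unfolding sublist_def by (metis subst_word_pow_append)

lemma sublist_singleton: "x \<in> set xs \<Longrightarrow> sublist [x] xs"
  by (metis split_list append_Cons append_Nil sublist_appendI)

lemma subst_language_sublist:
  "v \<in> subst_language A \<alpha> \<Longrightarrow> sublist u v \<Longrightarrow> u \<in> subst_language A \<alpha>"
  unfolding subst_language_def using sublist_order.order_trans by blast

lemma subst_word_pow_in_language:
  assumes "w \<in> subst_language A \<alpha>"
  shows "(subst_word \<alpha> ^^ k) w \<in> subst_language A \<alpha>"
proof -
  obtain a n where a: "a \<in> A" "n \<ge> 1" "sublist w ((subst_word \<alpha> ^^ n) [a])"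
    using assms by (auto simp: subst_language_def)
  have "sublist ((subst_word \<alpha> ^^ k) w) ((subst_word \<alpha> ^^ (k + n)) [a])"
    using sublist_subst_word_pow[OF a(3)] by (simp add: funpow_add)
  then show ?thesis
    using a(1,2) unfolding subst_language_def by (metis (mono_tags, lifting) mem_Collect_eq trans_le_add2)
qed

section \<open>Windows of finite words and bi-infinite sequences\<close>

lemma length_factor_at [simp]: "length (factor_at x i n) = n"
  by (simp add: factor_at_def)

lemma nth_factor_at [simp]: "k < n \<Longrightarrow> factor_at x i n ! k = x (i + int k)"
  by (simp add: factor_at_def)

text \<open>The windows are truncated from the first \<open>i\<close> with \<open>i + N > length u\<close> on.\<close>

definition blocks :: "nat \<Rightarrow> nat \<Rightarrow> 'a list \<Rightarrow> 'a list list" where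
  "blocks N m u = map (\<lambda>i. take N (drop i u)) [0..<m]"

lemma length_blocks [simp]: "length (blocks N m u) = m"
  by (simp add: blocks_def)

lemma nth_blocks [simp]: "i < m \<Longrightarrow> blocks N m u ! i = take N (drop i u)"
  by (simp add: blocks_def)

lemma blocks_add: "blocks N (m + k) u = blocks N m u @ blocks N k (drop m u)"
  by (rule nth_equalityI) (auto simp: nth_append add.commute)

text \<open>The last of the \<open>m\<close> windows ends at position \<open>m - 1 + N\<close>,
  still inside \<open>u\<close>, so no window reaches \<open>v\<close>.\<close>

lemma blocks_append:
  assumes "m + N \<le> length u + 1"
  shows "blocks N m (u @ v) = blocks N m u"
  by (rule nth_equalityI) (use assms in auto)

text \<open>This is \<open>(K - 1) * (N - 1) \<ge> 0\<close> expanded. With \<open>K\<close> a power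
  of \<open>L\<close> it says that an image of length \<open>K * N\<close> has room for
  \<open>K\<close> full windows of length \<open>N\<close>.\<close>

lemma block_length_le: "N \<ge> 1 \<Longrightarrow> K \<ge> 1 \<Longrightarrow> K + N \<le> K * N + (1 :: nat)"
  by (cases N; cases K) auto

section \<open>Continuity of maps given by finite windows\<close>

text \<open>The cylinder around \<open>x\<close> that fixes the coordinates in \<open>F\<close> is
  open, since only finitely many of its factors differ from \<open>A\<close>, and \<open>f\<close>
  is constant on its part in \<open>S\<close>.\<close>

lemma finite_coordinates_continuous_map:
  assumes "finite F" and "S \<subseteq> UNIV \<rightarrow> A" and "f \<in> S \<rightarrow> B"
    and local: "\<And>x y. x \<in> S \<Longrightarrow> y \<in> S \<Longrightarrow> (\<And>i. i \<in> F \<Longrightarrow> x i = y i) \<Longrightarrow> f x = f y"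
  shows "continuous_map (subtopology (product_topology (\<lambda>_. discrete_topology A) UNIV) S)
           (discrete_topology B) f"
proof -
  let ?T = "product_topology (\<lambda>_. discrete_topology A) UNIV"
  have S: "topspace (subtopology ?T S) = S"
    using assms(2) by (auto simp: PiE_def)
  have "openin (subtopology ?T S) {x \<in> S. f x \<in> U}" for U
  proof (subst openin_subopen, safe)
    fix x assume x: "x \<in> S" "f x \<in> U"
    let ?P = "PiE UNIV (\<lambda>i. if i \<in> F then {x i} else A)"
    have "openin ?T ?P"
      unfolding openin_PiE_gen using assms(1,2) x(1)
      by (auto intro: finite_subset[of _ F])
    then have "openin (subtopology ?T S) (S \<inter> ?P)"
      by (metis openin_subtopology_Int2)
    moreover have "x \<in> S \<inter> ?P"
      using x(1) subsetD[OF assms(2) x(1)] by (auto simp: Pi_iff)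
    moreover have "S \<inter> ?P \<subseteq> {x \<in> S. f x \<in> U}"
    proof safe
      fix y assume "y \<in> S" "y \<in> ?P"
      then have "f x = f y"
        by (intro local x(1)) (auto simp: PiE_def Pi_def split: if_splits)
      then show "f y \<in> U" using x(2) by simp
    qed
    ultimately show "\<exists>T. openin (subtopology ?T S) T \<and> x \<in> T \<and> T \<subseteq> {x \<in> S. f x \<in> U}"
      by blast
  qed
  then show ?thesis
    using assms(3) unfolding continuous_map_def S by simp
qed

text \<open>Continuity into a product is checked coordinatewise; \<open>F i\<close> is the window
  that a sliding block code reads to produce coordinate \<open>i\<close>.\<close>

lemma continuous_map_subst_topology:
  assumes "\<And>x. x \<in> subst_shift A \<alpha> \<Longrightarrow> f x \<in> subst_shift B \<beta>"
    and "\<And>i. finite (F i)"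
    and "\<And>i x y. x \<in> subst_shift A \<alpha> \<Longrightarrow> y \<in> subst_shift A \<alpha> \<Longrightarrow>
           (\<And>j. j \<in> F i \<Longrightarrow> x j = y j) \<Longrightarrow> f x i = f y i"
  shows "continuous_map (subst_topology A \<alpha>) (subst_topology B \<beta>) f"
proof -
  have "continuous_map (subst_topology A \<alpha>) (discrete_topology B) (\<lambda>x. f x i)" for i
    unfolding subst_topology_def
  proof (rule finite_coordinates_continuous_map[where F = "F i"])
    show "(\<lambda>x. f x i) \<in> subst_shift A \<alpha> \<rightarrow> B"
    proof
      fix x assume "x \<in> subst_shift A \<alpha>"
      then show "f x i \<in> B"
        using assms(1)[of x] by (auto simp: subst_shift_def)
    qed
    show "subst_shift A \<alpha> \<subseteq> UNIV \<rightarrow> A"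
      by (auto simp: subst_shift_def)
  qed (fact assms(2,3))+
  then have "continuous_map (subst_topology A \<alpha>) (product_topology (\<lambda>_. discrete_topology B) UNIV) f"
    by (simp add: continuous_map_componentwise_UNIV)
  then show ?thesis
    unfolding subst_topology_def[of B]
    by (rule continuous_map_into_subtopology) (simp add: topspace_subst_topology assms(1) Pi_iff)
qed

section \<open>Growth of the number of words in an infinite system\<close>

lemma finite_words_in_language:
  assumes "finite A" and "subst_language A \<alpha> \<subseteq> lists A"
  shows "finite {w \<in> subst_language A \<alpha>. length w = N}"
  by (rule finite_subset[OF _ finite_lists_length_eq[OF assms(1), of N]]) (use assms(2) in auto)

text \<open>Any \<open>K\<close> distinct points differ pairwise somewhere, and one central window
  that contains a place of difference for each pair turns them into \<open>K\<close> distinct words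
  of the same length.\<close>

lemma word_count_unbounded:
  assumes "finite A" and "subst_language A \<alpha> \<subseteq> lists A" and "infinite (subst_shift A \<alpha>)"
  shows "\<exists>N\<ge>1. card {w \<in> subst_language A \<alpha>. length w = N} \<ge> K"
proof -
  obtain P where P: "P \<subseteq> subst_shift A \<alpha>" "finite P" "card P = K"
    using infinite_arbitrarily_large[OF assms(3)] by blast
  define D where "D = (\<lambda>x y :: int \<Rightarrow> 'a. SOME i. x i \<noteq> y i)"
  have D: "x (D x y) \<noteq> y (D x y)" if "x \<noteq> y" for x y
    unfolding D_def by (rule someI_ex) (use that in \<open>simp add: fun_eq_iff\<close>)
  \<comment> \<open>A sum of nonnegative terms bounds each of them, so every chosen place of
    difference lies between \<open>- M\<close> and \<open>M\<close>. The diagonal terms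
    \<open>D x x\<close> are arbitrary and can only enlarge \<open>M\<close>.\<close>
  define M where "M = (\<Sum>(x, y)\<in>P \<times> P. nat \<bar>D x y\<bar>)"
  let ?W = "\<lambda>x. factor_at x (- int M) (2 * M + 1)"
  have "inj_on ?W P"
  proof (rule inj_onI, rule ccontr)
    fix x y assume xy: "x \<in> P" "y \<in> P" "?W x = ?W y" "x \<noteq> y"
    have "(case (x, y) of (x, y) \<Rightarrow> nat \<bar>D x y\<bar>) \<le> M"
      unfolding M_def using xy P(2) by (intro member_le_sum) auto
    then have "nat (D x y + int M) < 2 * M + 1" "D x y = - int M + int (nat (D x y + int M))"
      by auto
    then show False
      using D[OF xy(4)] xy(3) by (metis nth_factor_at)
  qed
  moreover have "?W ` P \<subseteq> {w \<in> subst_language A \<alpha>. length w = 2 * M + 1}"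
    using P(1) by (auto simp: subst_shift_def)
  ultimately have "K \<le> card {w \<in> subst_language A \<alpha>. length w = 2 * M + 1}"
    using P(3) card_inj_on_le finite_words_in_language[OF assms(1,2)] by blast
  then show ?thesis
    by (intro exI[of _ "2 * M + 1"]) auto
qed

section \<open>The block substitution and its alphabet\<close>

locale constant_length_subst =
  fixes A :: "'a set" and \<alpha> :: "'a \<Rightarrow> 'a list" and L :: nat
  assumes subst: "substitution_on A \<alpha>"
    and const: "constant_length A \<alpha> L" and L_gt_1: "L > 1"
    and prim: "primitive_subst A \<alpha>"
begin

definition words :: "nat \<Rightarrow> 'a list set" where
  "words N = {w \<in> subst_language A \<alpha>. length w = N}"

text \<open>The theorem asks for letters of type \<open>nat\<close>. Words over a finite alphabet
  form a countable set, so they can be numbered; \<open>decode\<close> inverts this numbering on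
  \<open>lists A\<close>.\<close>

definition code :: "'a list \<Rightarrow> nat" where
  "code = to_nat_on (lists A)"

definition decode :: "nat \<Rightarrow> 'a list" where
  "decode = from_nat_into (lists A)"

definition block_alphabet :: "nat \<Rightarrow> nat set" where
  "block_alphabet N = code ` words N"

text \<open>The \<open>L\<close> windows are those that start inside the image of the first letter
  of the decoded block. Overlapping blocks thus contribute adjacent runs of windows, without
  repetition.\<close>

definition block_subst :: "nat \<Rightarrow> nat \<Rightarrow> nat list" where
  "block_subst N c = map code (blocks N L (subst_word \<alpha> (decode c)))"

lemma finite_A: "finite A"
  using subst by (simp add: substitution_on_def alphabet_def)

lemma decode_code [simp]: "w \<in> lists A \<Longrightarrow> decode (code w) = w"
  unfolding decode_def code_def
  by (rule from_nat_into_to_nat_on) (use finite_A in \<open>auto intro: countable_finite\<close>)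

lemma subst_word_lists: "w \<in> lists A \<Longrightarrow> subst_word \<alpha> w \<in> lists A"
  using subst by (auto simp: subst_word_def substitution_on_def Pi_iff in_lists_conv_set)

lemma length_subst_word: "w \<in> lists A \<Longrightarrow> length (subst_word \<alpha> w) = L * length w"
  using const by (induction w) (auto simp: subst_word_def constant_length_def)

lemma subst_word_pow_lists: "w \<in> lists A \<Longrightarrow> (subst_word \<alpha> ^^ n) w \<in> lists A"
  by (induction n) (simp_all add: subst_word_lists del: in_lists_conv_set)

lemma length_subst_word_pow:
  "w \<in> lists A \<Longrightarrow> length ((subst_word \<alpha> ^^ n) w) = L ^ n * length w"
  by (induction n) (simp_all add: length_subst_word subst_word_pow_lists del: in_lists_conv_set)

lemma subst_language_lists: "subst_language A \<alpha> \<subseteq> lists A"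
proof
  fix w assume "w \<in> subst_language A \<alpha>"
  then obtain a n where "a \<in> A" "sublist w ((subst_word \<alpha> ^^ n) [a])"
    by (auto simp: subst_language_def)
  then show "w \<in> lists A"
    using subst_word_pow_lists[of "[a]" n] set_mono_sublist by (fastforce simp: in_lists_conv_set)
qed

lemma words_lists: "w \<in> words N \<Longrightarrow> w \<in> lists A"
  using subst_language_lists by (auto simp: words_def)

lemma finite_words: "finite (words N)"
  unfolding words_def using finite_A subst_language_lists by (rule finite_words_in_language)

lemma inj_on_code: "inj_on code (words N)"
  by (metis decode_code inj_onI words_lists)

lemma card_block_alphabet: "card (block_alphabet N) = card (words N)"
  unfolding block_alphabet_def by (rule card_image[OF inj_on_code])

section \<open>Recurrence of words and iterates of the block substitution\<close>

text \<open>The word \<open>u\<close> lies in the \<open>m\<close>-th image of a letter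
  \<open>a\<close>, which by primitivity lies in the \<open>p\<close>-th image of every letter
  \<open>c\<close>; the remaining \<open>k\<close> iterations may come first, as they only change
  \<open>c\<close>. Having all large exponents allows a common one for finitely many words.\<close>

lemma language_occurs_eventually:
  assumes "u \<in> subst_language A \<alpha>"
  shows "\<exists>k. \<forall>n\<ge>k. \<forall>b\<in>A. sublist u ((subst_word \<alpha> ^^ n) [b])"
proof -
  obtain a m where a: "a \<in> A" "sublist u ((subst_word \<alpha> ^^ m) [a])"
    using assms by (auto simp: subst_language_def)
  obtain p where p: "\<forall>a\<in>A. A \<subseteq> set ((subst_word \<alpha> ^^ p) [a])"
    using prim by (auto simp: primitive_subst_def)
  have "sublist u ((subst_word \<alpha> ^^ n) [b])" if n: "n \<ge> m + p" and b: "b \<in> A" for n b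
  proof -
    define k where "k = n - (m + p)"
    have "(subst_word \<alpha> ^^ k) [b] \<noteq> []"
      using length_subst_word_pow[of "[b]" k] b L_gt_1 by force
    then obtain c where c: "c \<in> set ((subst_word \<alpha> ^^ k) [b])"
      by (meson list.set_sel(1))
    then have "c \<in> A"
      using subst_word_pow_lists[of "[b]" k] b by (auto simp: in_lists_conv_set)
    then have "sublist [a] ((subst_word \<alpha> ^^ p) [c])"
      using p a(1) by (intro sublist_singleton) blast
    also have "sublist \<dots> ((subst_word \<alpha> ^^ p) ((subst_word \<alpha> ^^ k) [b]))"
      using c by (intro sublist_subst_word_pow sublist_singleton)
    finally have "sublist ((subst_word \<alpha> ^^ m) [a])
        ((subst_word \<alpha> ^^ m) ((subst_word \<alpha> ^^ p) ((subst_word \<alpha> ^^ k) [b])))"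
      by (rule sublist_subst_word_pow)
    also have "\<dots> = (subst_word \<alpha> ^^ (m + p + k)) [b]"
      by (simp add: funpow_add)
    also have "m + p + k = n"
      using n by (simp add: k_def)
    finally show ?thesis
      using a(2) sublist_order.order_trans by blast
  qed
  then show ?thesis by blast
qed

lemma window_in_words:
  assumes "u \<in> subst_language A \<alpha>" and "i + N \<le> length u"
  shows "take N (drop i u) \<in> words N"
proof -
  have "sublist (take N (drop i u)) u"
    by (meson sublist_drop sublist_order.order_trans sublist_take)
  then show ?thesis
    using assms subst_language_sublist by (auto simp: words_def)
qed

text \<open>Passing to windows intertwines the two substitutions. In the induction the window
  \<open>q\<close> at position \<open>m\<close> is mapped to the stretch starting at
  \<open>L * m\<close>, and its \<open>L\<close> new windows are already visible in the image of
  \<open>q\<close>.\<close>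

lemma subst_word_blocks:
  assumes "N \<ge> 1" and "u \<in> lists A" and "m + N \<le> length u + 1"
  shows "subst_word (block_subst N) (map code (blocks N m u)) =
           map code (blocks N (L * m) (subst_word \<alpha> u))"
  using assms(3)
proof (induction m)
  case 0
  then show ?case by (simp add: subst_word_def blocks_def)
next
  case (Suc m)
  define p q r where "p = take m u" and "q = take N (drop m u)" and "r = drop N (drop m u)"
  have u: "u = p @ q @ r"
    by (metis append_take_drop_id p_def q_def r_def)
  then have pq: "p \<in> lists A" "q \<in> lists A"
    using assms(2) by (simp_all del: in_lists_conv_set)
  have len: "length p = m" "length q = N"
    using Suc.prems by (auto simp: p_def q_def)
  \<comment> \<open>The image of \<open>q\<close> has length \<open>L * N\<close>, at least
    \<open>L + N - 1\<close>, so its first \<open>L\<close> windows do not see the image of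
    \<open>r\<close>.\<close>
  have "blocks N L (subst_word \<alpha> q @ subst_word \<alpha> r) = blocks N L (subst_word \<alpha> q)"
    using length_subst_word[OF pq(2)] block_length_le[of N L] assms(1) L_gt_1 len
    by (intro blocks_append) auto
  then have 1: "blocks N (L * Suc m) (subst_word \<alpha> u) =
      blocks N (L * m) (subst_word \<alpha> u) @ blocks N L (subst_word \<alpha> q)"
    using length_subst_word[OF pq(1)] len
    by (simp add: blocks_add add.commute[of L] u subst_word_append)
  have 2: "blocks N (Suc m) u = blocks N m u @ [q]"
    using blocks_add[of N m 1 u] by (simp add: blocks_def q_def)
  have 3: "subst_word (block_subst N) [code q] = map code (blocks N L (subst_word \<alpha> q))"
    using pq(2) by (simp add: subst_word_def block_subst_def del: in_lists_conv_set)
  show ?case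
    using Suc by (simp add: 1 2 3 subst_word_append del: mult_Suc_right)
qed

text \<open>The intertwining is iterated from a single window; at stage \<open>n\<close> the image
  of \<open>w\<close> has length \<open>L ^ n * N\<close>, enough for \<open>L ^ n\<close> full
  windows.\<close>

lemma subst_word_pow_block_subst:
  assumes "N \<ge> 1" and "w \<in> words N"
  shows "(subst_word (block_subst N) ^^ n) [code w] =
           map code (blocks N (L ^ n) ((subst_word \<alpha> ^^ n) w))"
proof (induction n)
  case 0
  then show ?case using assms by (simp add: blocks_def words_def)
next
  case (Suc n)
  have "L ^ n + N \<le> length ((subst_word \<alpha> ^^ n) w) + 1"
    using block_length_le[OF assms(1), of "L ^ n"] L_gt_1 assms(2)
      length_subst_word_pow[OF words_lists[OF assms(2)], of n]
    by (simp add: words_def)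
  then show ?case
    using subst_word_blocks[OF assms(1) subst_word_pow_lists[OF words_lists[OF assms(2)]]] Suc
    by simp
qed

lemma substitution_on_block_subst:
  assumes "N \<ge> 1" and "card (words N) \<ge> 2"
  shows "substitution_on (block_alphabet N) (block_subst N)"
  unfolding substitution_on_def alphabet_def
proof (intro conjI)
  show "finite (block_alphabet N)" "2 \<le> card (block_alphabet N)"
    using assms(2) finite_words card_block_alphabet by (auto simp: block_alphabet_def)
  have "take N (drop i (subst_word \<alpha> w)) \<in> words N" if "w \<in> words N" "i < L" for w i
  proof (rule window_in_words)
    show "subst_word \<alpha> w \<in> subst_language A \<alpha>"
      using subst_word_pow_in_language[of w A \<alpha> 1] that by (simp add: words_def)
    show "i + N \<le> length (subst_word \<alpha> w)"
      using length_subst_word[OF words_lists[OF that(1)]] that block_length_le[OF assms(1), of L]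
      by (auto simp: words_def)
  qed
  then show "block_subst N \<in> block_alphabet N \<rightarrow> lists (block_alphabet N)"
    using words_lists by (auto simp: block_alphabet_def block_subst_def blocks_def simp del: in_lists_conv_set)
qed

text \<open>By the formula for iterates, \<open>code u\<close> appears once \<open>u\<close> starts
  before position \<open>L ^ n\<close> in the \<open>n\<close>-th image of \<open>w\<close>. It does
  so if \<open>u\<close> occurs in the \<open>n\<close>-th image of the first letter
  \<open>b\<close> of \<open>w\<close>.\<close>

lemma primitive_block_subst:
  assumes "N \<ge> 1"
  shows "primitive_subst (block_alphabet N) (block_subst N)"
proof -
  have "\<forall>u\<in>words N. \<exists>k. \<forall>n\<ge>k. \<forall>b\<in>A. sublist u ((subst_word \<alpha> ^^ n) [b])"
    using language_occurs_eventually by (simp add: words_def)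
  then obtain k where
    k: "\<And>u n b. u \<in> words N \<Longrightarrow> n \<ge> k u \<Longrightarrow> b \<in> A \<Longrightarrow> sublist u ((subst_word \<alpha> ^^ n) [b])"
    by metis
  \<comment> \<open>The sum dominates every \<open>k u\<close>, so one exponent serves all words;
    \<open>Suc\<close> makes it positive.\<close>
  define n where "n = Suc (\<Sum>u\<in>words N. k u)"
  have "code u \<in> set ((subst_word (block_subst N) ^^ n) [code w])"
    if u: "u \<in> words N" and w: "w \<in> words N" for u w
  proof -
    have "w \<noteq> []" using w assms by (auto simp: words_def)
    then obtain b w' where bw: "w = b # w'" by (meson neq_Nil_conv)
    then have b: "b \<in> A" using words_lists[OF w] by simp
    have "k u \<le> n"
      unfolding n_def using u finite_words by (simp add: le_Suc_eq member_le_sum)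
    then have "sublist u ((subst_word \<alpha> ^^ n) [b])"
      using k u b by blast
    then obtain p q where pq: "(subst_word \<alpha> ^^ n) [b] = p @ u @ q"
      by (auto simp: sublist_def)
    have lens: "length u = N" using u by (simp add: words_def)
    \<comment> \<open>Strict because \<open>u\<close> is nonempty and ends within the first
      \<open>L ^ n\<close> letters.\<close>
    then have "length p < L ^ n"
      using arg_cong[OF pq, of length] length_subst_word_pow[of "[b]" n] b assms by simp
    moreover have "take N (drop (length p) ((subst_word \<alpha> ^^ n) w)) = u"
      using subst_word_pow_append[of n \<alpha> "[b]" w'] pq bw lens by simp
    ultimately have "u \<in> set (blocks N (L ^ n) ((subst_word \<alpha> ^^ n) w))"
      unfolding blocks_def by force
    then show ?thesis
      using subst_word_pow_block_subst[OF assms w] by simp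
  qed
  then show ?thesis
    unfolding primitive_subst_def
    by (intro exI[of _ n]) (auto simp: n_def block_alphabet_def)
qed

section \<open>The language of the block substitution\<close>

text \<open>An iterate of the block substitution lists consecutive windows of a word
  \<open>x\<close>. A factor \<open>v\<close> preceded by \<open>p\<close> is therefore the run of
  windows starting at \<open>length p\<close>, and \<open>u\<close> is \<open>x\<close> without its
  first \<open>length p\<close> letters, possibly longer than \<open>v\<close> requires.\<close>

lemma block_language_imp:
  assumes "N \<ge> 1" and "v \<in> subst_language (block_alphabet N) (block_subst N)"
  obtains u where "u \<in> subst_language A \<alpha>" "length v + N \<le> length u + 1"
    "v = map code (blocks N (length v) u)"
proof -
  obtain w n where w: "w \<in> words N"
    and v: "sublist v ((subst_word (block_subst N) ^^ n) [code w])"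
    using assms(2) by (auto simp: subst_language_def block_alphabet_def)
  define x where "x = (subst_word \<alpha> ^^ n) w"
  have x: "x \<in> subst_language A \<alpha>"
    using w subst_word_pow_in_language[of w A \<alpha> n] by (simp add: x_def words_def)
  have lx: "L ^ n + N \<le> length x + 1"
    using block_length_le[OF assms(1), of "L ^ n"] L_gt_1 w
      length_subst_word_pow[OF words_lists[OF w], of n] by (simp add: words_def x_def)
  obtain p q where pq: "map code (blocks N (L ^ n) x) = p @ v @ q"
    using v subst_word_pow_block_subst[OF assms(1) w, of n] by (auto simp: sublist_def x_def)
  then have len: "L ^ n = length p + (length v + length q)"
    by (metis length_append length_blocks length_map)
  show thesis
  proof
    show "drop (length p) x \<in> subst_language A \<alpha>"
      using x sublist_drop subst_language_sublist by blast
    show "length v + N \<le> length (drop (length p) x) + 1"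
      using len lx assms(1) by simp
    have "p @ v @ q = map code (blocks N (length p) x) @
        map code (blocks N (length v) (drop (length p) x)) @
        map code (blocks N (length q) (drop (length v) (drop (length p) x)))"
      unfolding pq[symmetric] len by (simp only: blocks_add map_append)
    then show "v = map code (blocks N (length v) (drop (length p) x))"
      by (simp add: append_eq_append_conv)
  qed
qed

text \<open>An occurrence of \<open>u\<close> in an iterate on the first letter of a block
  \<open>w\<close> starts among the first \<open>L ^ n\<close> positions, and so do all
  \<open>m\<close> windows of \<open>u\<close>; hence their codes form a factor of the iterate on
  \<open>code w\<close>.\<close>

lemma block_language_intro:
  assumes "N \<ge> 1" and "words N \<noteq> {}"
    and u: "u \<in> subst_language A \<alpha>" "length u + 1 = m + N"
  shows "map code (blocks N m u) \<in> subst_language (block_alphabet N) (block_subst N)"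
proof -
  obtain w where w: "w \<in> words N" using assms(2) by blast
  then obtain b w' where bw: "w = b # w'"
    using assms(1) by (cases w) (auto simp: words_def)
  then have b: "b \<in> A" using words_lists[OF w] by simp
  obtain n where n: "n \<ge> 1" "sublist u ((subst_word \<alpha> ^^ n) [b])"
    using language_occurs_eventually[OF u(1)] b by (meson nle_le)
  then obtain p q where pq: "(subst_word \<alpha> ^^ n) [b] = p @ u @ q"
    by (auto simp: sublist_def)
  \<comment> \<open>The number of windows left after those of \<open>p\<close> and \<open>u\<close>;
    the subtraction does not truncate, since \<open>m \<le> length u\<close>.\<close>
  define r where "r = L ^ n - length p - m"
  have "L ^ n = length p + length u + length q"
    using arg_cong[OF pq, of length] length_subst_word_pow[of "[b]" n] b by simp
  then have r: "L ^ n = length p + (m + r)"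
    using u(2) assms(1) by (simp add: r_def)
  define x where "x = (subst_word \<alpha> ^^ n) w"
  have x: "x = p @ u @ q @ (subst_word \<alpha> ^^ n) w'"
    using subst_word_pow_append[of n \<alpha> "[b]" w'] pq bw by (simp add: x_def)
  have "blocks N m (drop (length p) x) = blocks N m u"
    unfolding x using u(2) by (simp add: blocks_append)
  then have "map code (blocks N (L ^ n) x) = map code (blocks N (length p) x) @
      map code (blocks N m u) @ map code (blocks N r (drop m (drop (length p) x)))"
    unfolding r by (simp only: blocks_add map_append)
  then have "sublist (map code (blocks N m u)) ((subst_word (block_subst N) ^^ n) [code w])"
    using subst_word_pow_block_subst[OF assms(1) w, of n] by (simp add: x_def)
  then show ?thesis
    using n(1) w by (auto simp: subst_language_def block_alphabet_def)
qed

section \<open>The conjugacy and its inverse\<close>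

definition to_blocks :: "nat \<Rightarrow> (int \<Rightarrow> 'a) \<Rightarrow> int \<Rightarrow> nat" where
  "to_blocks N x i = code (factor_at x i N)"

definition from_blocks :: "(int \<Rightarrow> nat) \<Rightarrow> int \<Rightarrow> 'a" where
  "from_blocks y i = hd (decode (y i))"

lemma factor_at_words: "x \<in> subst_shift A \<alpha> \<Longrightarrow> factor_at x i N \<in> words N"
  by (simp add: subst_shift_def words_def)

lemma to_blocks_in_shift:
  assumes "N \<ge> 1" and "x \<in> subst_shift A \<alpha>"
  shows "to_blocks N x \<in> subst_shift (block_alphabet N) (block_subst N)"
  unfolding subst_shift_def
proof (intro CollectI conjI allI)
  show "to_blocks N x \<in> UNIV \<rightarrow> block_alphabet N"
    using factor_at_words[OF assms(2)] by (simp add: to_blocks_def block_alphabet_def)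
  fix i m
  have "to_blocks N x (i + int k) = code (take N (drop k (factor_at x i (m + N - 1))))"
    if "k < m" for k
  proof -
    have "factor_at x (i + int k) N = take N (drop k (factor_at x i (m + N - 1)))"
      using that by (intro nth_equalityI) (auto simp: add.assoc)
    then show ?thesis by (simp add: to_blocks_def)
  qed
  \<comment> \<open>Exactly \<open>m\<close> windows of length \<open>N\<close> fit in
    \<open>m + N - 1\<close> letters.\<close>
  then have "factor_at (to_blocks N x) i m = map code (blocks N m (factor_at x i (m + N - 1)))"
    by (intro nth_equalityI) auto
  moreover have "words N \<noteq> {}"
    using factor_at_words[OF assms(2)] by blast
  ultimately show "factor_at (to_blocks N x) i m \<in> subst_language (block_alphabet N) (block_subst N)"
    using block_language_intro[OF assms(1), of "factor_at x i (m + N - 1)" m] assms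
    by (simp add: subst_shift_def)
qed

text \<open>Membership in the block system forces neighbouring blocks to overlap consistently: any
  \<open>m\<close> of them are windows of one word \<open>u\<close>, so their first letters spell
  the beginning of \<open>u\<close>.\<close>

lemma factor_at_from_blocks:
  assumes "N \<ge> 1" and "y \<in> subst_shift (block_alphabet N) (block_subst N)"
  obtains u where "u \<in> subst_language A \<alpha>" "m + N \<le> length u + 1"
    "factor_at y i m = map code (blocks N m u)" "factor_at (from_blocks y) i m = take m u"
proof -
  have "factor_at y i m \<in> subst_language (block_alphabet N) (block_subst N)"
    using assms(2) by (simp add: subst_shift_def)
  then obtain u where u: "u \<in> subst_language A \<alpha>" "m + N \<le> length u + 1"
    "factor_at y i m = map code (blocks N m u)"
    using block_language_imp[OF assms(1)] by (metis length_factor_at)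
  have "from_blocks y (i + int k) = u ! k" if "k < m" for k
  proof -
    have "y (i + int k) = code (take N (drop k u))"
      using arg_cong[OF u(3), of "\<lambda>v. v ! k"] that by simp
    moreover have "take N (drop k u) \<in> words N"
      using u that by (intro window_in_words) auto
    ultimately have "from_blocks y (i + int k) = hd (take N (drop k u))"
      using words_lists by (simp add: from_blocks_def del: in_lists_conv_set)
    also have "\<dots> = u ! k"
      using u(2) that assms(1) by (simp add: hd_drop_conv_nth)
    finally show ?thesis .
  qed
  then have "factor_at (from_blocks y) i m = take m u"
    by (intro nth_equalityI) (use u(2) assms(1) in auto)
  with u that show thesis by blast
qed

lemma from_blocks_in_shift:
  assumes "N \<ge> 1" and "y \<in> subst_shift (block_alphabet N) (block_subst N)"
  shows "from_blocks y \<in> subst_shift A \<alpha>"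
proof -
  have 1: "factor_at (from_blocks y) i m \<in> subst_language A \<alpha>" for i m
    using factor_at_from_blocks[OF assms, of m i] subst_language_sublist sublist_take by metis
  have "from_blocks y i \<in> A" for i
    using 1[of i 1] subst_language_lists by (auto simp: factor_at_def)
  with 1 show ?thesis by (simp add: subst_shift_def)
qed

lemma from_to_blocks:
  assumes "N \<ge> 1" and "x \<in> subst_shift A \<alpha>"
  shows "from_blocks (to_blocks N x) = x"
proof
  fix i
  have "decode (code (factor_at x i N)) = factor_at x i N"
    by (rule decode_code[OF words_lists[OF factor_at_words[OF assms(2)]]])
  moreover have "hd (factor_at x i N) = x i"
    using assms(1) by (subst hd_conv_nth) (auto simp flip: length_greater_0_conv)
  ultimately show "from_blocks (to_blocks N x) i = x i"
    by (simp add: from_blocks_def to_blocks_def)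
qed

text \<open>With \<open>m = N\<close> the same \<open>take N u\<close> arises twice: as the block at
  \<open>i\<close>, and as the first letters of the \<open>N\<close> blocks from \<open>i\<close>
  on.\<close>

lemma to_from_blocks:
  assumes "N \<ge> 1" and "y \<in> subst_shift (block_alphabet N) (block_subst N)"
  shows "to_blocks N (from_blocks y) = y"
proof
  fix i
  obtain u where u: "factor_at y i N = map code (blocks N N u)"
    "factor_at (from_blocks y) i N = take N u"
    using factor_at_from_blocks[OF assms] by metis
  have "y i = code (take N u)"
    using arg_cong[OF u(1), of "\<lambda>v. v ! 0"] assms(1) by simp
  then show "to_blocks N (from_blocks y) i = y i"
    by (simp add: to_blocks_def u(2))
qed

lemma conjugate_block_subst:
  assumes "N \<ge> 1"
  shows "topologically_conjugate (block_alphabet N) (block_subst N) A \<alpha>"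
  unfolding topologically_conjugate_def
proof (intro exI[of _ from_blocks] conjI ballI)
  have "continuous_map (subst_topology (block_alphabet N) (block_subst N)) (subst_topology A \<alpha>) from_blocks"
    by (rule continuous_map_subst_topology[where F = "\<lambda>i. {i}"])
      (auto simp: from_blocks_def from_blocks_in_shift[OF assms])
  \<comment> \<open>The block at \<open>i\<close> reads coordinates \<open>i\<close> to
    \<open>i + N - 1\<close>, all in the chosen interval.\<close>
  moreover have "continuous_map (subst_topology A \<alpha>) (subst_topology (block_alphabet N) (block_subst N)) (to_blocks N)"
    by (rule continuous_map_subst_topology[where F = "\<lambda>i. {i..i + int N}"])
      (auto simp: to_blocks_def factor_at_def to_blocks_in_shift[OF assms]
        intro!: arg_cong[of _ _ code])
  ultimately show "homeomorphic_map (subst_topology (block_alphabet N) (block_subst N)) (subst_topology A \<alpha>) from_blocks"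
    using from_to_blocks[OF assms] to_from_blocks[OF assms]
    by (auto simp: homeomorphic_map_maps homeomorphic_maps_def topspace_subst_topology)
qed (simp add: from_blocks_def left_shift_def fun_eq_iff)

lemma constant_length_block_subst: "constant_length (block_alphabet N) (block_subst N) L"
  by (simp add: constant_length_def block_subst_def)

end

section \<open>Infinitely many alphabet sizes\<close>

theorem theorem4p1:
  fixes A :: "'a set" and \<alpha> :: "'a \<Rightarrow> 'a list" and L :: nat
  assumes "substitution_on A \<alpha>"
    and "constant_length A \<alpha> L" and "L > 1"
    and "primitive_subst A \<alpha>"
    and "infinite (subst_shift A \<alpha>)"
  shows "\<exists>S :: (nat set \<times> (nat \<Rightarrow> nat list)) set.
           infinite S \<and>
           (\<forall>(B, \<beta>)\<in>S. substitution_on B \<beta> \<and> constant_length B \<beta> L \<and> primitive_subst B \<beta> \<and>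
              topologically_conjugate B \<beta> A \<alpha>) \<and>
           pairwise (\<lambda>(B, \<beta>) (C, \<gamma>). \<not> renaming_equivalent B \<beta> C \<gamma>) S"
proof -
  interpret constant_length_subst A \<alpha> L
    using assms by unfold_locales
  define I where "I = {N. N \<ge> 1 \<and> card (words N) \<ge> 2}"
  define C where "C = (card \<circ> words) ` I"
  \<comment> \<open>Asking for \<open>max K 2\<close> words makes the size large and keeps
    \<open>N\<close> in \<open>I\<close>.\<close>
  have "\<exists>c\<ge>K. c \<in> C" for K
  proof -
    obtain N where "N \<ge> 1" "card (words N) \<ge> max K 2"
      using word_count_unbounded[OF finite_A subst_language_lists assms(5), of "max K 2"]
      by (auto simp: words_def)
    then show ?thesis by (auto simp: C_def I_def)
  qed
  then have C: "infinite C"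
    by (auto simp: infinite_nat_iff_unbounded_le)
  \<comment> \<open>One \<open>N\<close> is kept for each size. Distinct members of \<open>S\<close>
    then have alphabets of different cardinality, which no bijective renaming can match.\<close>
  obtain J where J: "J \<subseteq> I" "inj_on (card \<circ> words) J" "C = (card \<circ> words) ` J"
    using subset_image_inj[of C "card \<circ> words" I] by (auto simp: C_def)
  define S where "S = (\<lambda>N. (block_alphabet N, block_subst N)) ` J"
  have "(\<lambda>p. card (fst p)) ` S = C"
    by (simp add: S_def J(3) image_image card_block_alphabet)
  then have "infinite S"
    using C finite_imageI by metis
  moreover have "\<forall>(B, \<beta>)\<in>S. substitution_on B \<beta> \<and> constant_length B \<beta> L \<and>
      primitive_subst B \<beta> \<and> topologically_conjugate B \<beta> A \<alpha>"
    using J(1) by (auto simp: S_def I_def substitution_on_block_subst constant_length_block_subst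
        primitive_block_subst conjugate_block_subst)
  moreover have "pairwise (\<lambda>(B, \<beta>) (C, \<gamma>). \<not> renaming_equivalent B \<beta> C \<gamma>) S"
    using J(2) unfolding pairwise_def S_def renaming_equivalent_def inj_on_def
    by (auto dest!: bij_betw_same_card simp: card_block_alphabet)
  ultimately show ?thesis by blast
qed

end
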